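(* Let $q$ be a complex number with $|q|<1$. Then \begin{align*} \sum_{n=0}^\infty \frac{(-1)^nq^{\frac{3}{2}n^2+\frac{5}{2}n}(q;q^3)_n}{(q^9;q^9)_n}=\frac{(q^4;q^6)_\infty (q^{12};q^{18})_\infty}{(q^5;q^6)_\infty (q^9;q^{18})_\infty}. \end{align*}
   Context: Notation ($q$-Pochhammer symbols): for complex $a$ and a base $p$ with $|p|<1$, $(a;p)_0:=1$, $(a;p)_n:=\prod_{k=0}^{n-1}(1-ap^k)$ for integers $n\ge 1$, and $(a;p)_\infty:=\prod_{k=0}^{\infty}(1-ap^k)$. The exponent $\frac{3}{2}n^2+\frac{5}{2}n=\frac{n(3n+5)}{2}$ is a nonnegative integer for every integer $n\ge 0$. *)

theory Defs
  imports "HOL-Analysis.Analysis"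
begin

definition qpoch :: "complex \<Rightarrow> complex \<Rightarrow> nat \<Rightarrow> complex" where
  "qpoch a p n = (\<Prod>k<n. 1 - a * p ^ k)"

definition qpoch_inf :: "complex \<Rightarrow> complex \<Rightarrow> complex" where
  "qpoch_inf a p = (\<Prod>k. 1 - a * p ^ k)"

text \<open>For a base of modulus less than 1 the infinite product is a genuine limit,
  so \<open>qpoch_inf\<close> does not fall back on the default value of \<^const>\<open>prodinf\<close>.\<close>

lemma qpoch_inf_has_prod:
  assumes "norm p < 1"
  shows "(\<lambda>k. 1 - a * p ^ k) has_prod qpoch_inf a p"
proof -
  have "summable (\<lambda>k. norm a * norm p ^ k)"
    using assms by (intro summable_mult summable_geometric) auto
  then have "summable (\<lambda>k. norm ((1 - a * p ^ k) - 1))"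
    by (simp add: norm_mult norm_power)
  then have "convergent_prod (\<lambda>k. 1 - a * p ^ k)"
    by (intro abs_convergent_prod_imp_convergent_prod summable_imp_abs_convergent_prod)
  then show ?thesis
    unfolding qpoch_inf_def by (rule convergent_prod_has_prod)
qed

lemma qpoch_tendsto_qpoch_inf:
  assumes "norm p < 1"
  shows "qpoch a p \<longlonglongrightarrow> qpoch_inf a p"
proof -
  have "(\<lambda>n. \<Prod>k\<le>n. 1 - a * p ^ k) \<longlonglongrightarrow> qpoch_inf a p"
    using qpoch_inf_has_prod[OF assms] by (rule has_prod_imp_tendsto)
  then have "(\<lambda>n. qpoch a p (Suc n)) \<longlonglongrightarrow> qpoch_inf a p"
    by (simp only: qpoch_def lessThan_Suc_atMost)
  then show ?thesis
    by (rule LIMSEQ_imp_Suc)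
qed

end

theory Submission
  imports Defs
begin

text \<open>
  The identity is one point of a two-parameter summation. Write \<open>p\<close> for the base and put
  \[ S(a) = \sum_{n \ge 0} \frac{(-1)^n p^{n(n+1)/2} (a;p)_n \prod_{k=1}^{n} (a - p^{2k})}
      {(p^3;p^3)_n (a^2 p;p^2)_n}
     = \frac{(ap;p^2)_\infty (a^3p^3;p^6)_\infty}{(a^2p;p^2)_\infty (p^3;p^6)_\infty}
     \qquad (|a|, |p| < 1). \]
  For \<open>p = q^3\<close> and \<open>a = q\<close> one has \<open>a - p^(2k) = q (1 - q^(6k - 1))\<close>, so that the last product in
  the numerator equals \<open>q^n (q^5;q^6)_n\<close>, while the second factor of the denominator is
  \<open>(q^5;q^6)_n\<close>: the two cancel, and what remains is the series in \<open>q\<close>. The free parameter \<open>a\<close>,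
  which this cancellation hides, is what makes the sum tractable.

  The proof is a Wilf-Zeilberger argument in \<open>a\<close>. The quotient on the right satisfies a first-order
  equation under \<open>a \<mapsto> a p^2\<close>; the summand satisfies the same equation up to the difference of
  consecutive values of an explicit function that vanishes at 0 and at infinity
  (\<open>cubic_telescope\<close>), hence so does \<open>S\<close> (\<open>cubic_sum_shift\<close>). Iterating the shift moves \<open>a\<close> to 0,
  where \<open>S\<close> is continuous by dominated convergence, and expresses \<open>S(a)\<close> through \<open>S(0)\<close>
  (\<open>cubic_sum_eq_at_0\<close>). The constant \<open>S(0)\<close> needs no separate summation: at \<open>a = p^2\<close> the series
  stops after its first term, so \<open>S(p^2) = 1\<close>, and the same formula read backwards gives \<open>S(0)\<close>.
\<close>

section \<open>Finite and infinite shifted factorials\<close>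

lemma qpoch_0 [simp]: "qpoch a p 0 = 1"
  by (simp add: qpoch_def)

lemma qpoch_Suc: "qpoch a p (Suc n) = qpoch a p n * (1 - a * p ^ n)"
  by (simp add: qpoch_def)

lemma qpoch_Suc_shift: "qpoch a p (Suc n) = (1 - a) * qpoch (a * p) p n"
  unfolding qpoch_def prod.lessThan_Suc_shift by (simp add: algebra_simps)

lemma qpoch_shift2:
  "(1 - a) * (1 - a * p) * qpoch (a * p ^ 2) p n
    = qpoch a p n * (1 - a * p ^ n) * (1 - a * p ^ Suc n)"
proof -
  have "(1 - a) * (1 - a * p) * qpoch (a * p ^ 2) p n = qpoch a p (Suc (Suc n))"
    by (simp add: qpoch_Suc_shift power2_eq_square mult.assoc)
  then show ?thesis
    by (simp add: qpoch_Suc)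
qed

lemma norm_mult_power_less_1:
  fixes a p :: complex
  assumes "norm a < 1" "norm p \<le> 1"
  shows "norm (a * p ^ k) < 1"
proof -
  have "norm a * norm p ^ k \<le> norm a * 1"
    using assms by (intro mult_left_mono power_le_one) auto
  with assms show ?thesis
    by (simp add: norm_mult norm_power)
qed

lemma one_minus_nonzero:
  fixes z :: complex
  assumes "norm z < 1"
  shows "1 - z \<noteq> 0"
  using assms by auto

lemma qpoch_nonzero:
  assumes "norm a < 1" "norm p \<le> 1"
  shows "qpoch a p n \<noteq> 0"
  unfolding qpoch_def
  using one_minus_nonzero[OF norm_mult_power_less_1[OF assms]] by simp

lemma qpoch_inf_nonzero:
  assumes "norm a < 1" "norm p < 1"
  shows "qpoch_inf a p \<noteq> 0"
proof -
  have "0 \<noteq> 1 - a * p ^ k" for k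
    using assms by (intro not_sym[OF one_minus_nonzero] norm_mult_power_less_1) auto
  then have "0 \<notin> range (\<lambda>k. 1 - a * p ^ k)"
    by blast
  then show ?thesis
    using has_prod_eq_0_iff[OF qpoch_inf_has_prod[OF assms(2)]] by metis
qed

lemma qpoch_inf_shift:
  assumes "norm p < 1"
  shows "qpoch_inf a p = (1 - a) * qpoch_inf (a * p) p"
proof -
  have "(\<lambda>n. qpoch a p (Suc n)) \<longlonglongrightarrow> qpoch_inf a p"
    using qpoch_tendsto_qpoch_inf[OF assms] by (rule LIMSEQ_Suc)
  moreover have "(\<lambda>n. qpoch a p (Suc n)) \<longlonglongrightarrow> (1 - a) * qpoch_inf (a * p) p"
    unfolding qpoch_Suc_shift by (intro tendsto_intros qpoch_tendsto_qpoch_inf assms)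
  ultimately show ?thesis
    by (rule LIMSEQ_unique)
qed

lemma norm_qpoch_upper:
  assumes "norm a \<le> 1" "norm p \<le> 1"
  shows "norm (qpoch a p n) \<le> 2 ^ n"
proof -
  have "norm (1 - a * p ^ k) \<le> 2" for k
  proof -
    have "norm (a * p ^ k) \<le> 1"
      using assms by (simp add: norm_mult norm_power mult_le_one power_le_one)
    with norm_triangle_ineq4[of 1 "a * p ^ k"] show ?thesis
      by simp
  qed
  then have "(\<Prod>k<n. norm (1 - a * p ^ k)) \<le> (\<Prod>k<n. 2)"
    by (intro prod_mono) auto
  then show ?thesis
    by (simp add: qpoch_def prod_norm)
qed

lemma norm_qpoch_lower:
  assumes "norm a \<le> r" "norm p \<le> 1" "r \<le> 1"
  shows "(1 - r) ^ n \<le> norm (qpoch a p n)"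
proof -
  have "1 - r \<le> norm (1 - a * p ^ k)" for k
  proof -
    have "norm a * norm p ^ k \<le> norm a * 1"
      using assms by (intro mult_left_mono power_le_one) auto
    then have "norm (a * p ^ k) \<le> r"
      using assms by (simp add: norm_mult norm_power)
    with norm_triangle_ineq2[of 1 "a * p ^ k"] show ?thesis
      by simp
  qed
  then have "(\<Prod>k<n. 1 - r) \<le> (\<Prod>k<n. norm (1 - a * p ^ k))"
    using assms by (intro prod_mono) auto
  then show ?thesis
    by (simp add: qpoch_def prod_norm)
qed

section \<open>The summand and its telescoping relation\<close>

text \<open>
  The numerator product is left open because two variants are needed: \<open>f k = a - p^(2k+2)\<close> gives
  the summand, and \<open>f k = a - p^(2k)\<close> gives a quantity that divides the summands at \<open>a\<close> and at
  \<open>a p^2\<close> alike. Writing the factors as \<open>a - p^(2k+2)\<close> instead of \<open>a (1 - p^(2k+2)/a)\<close> keeps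
  \<open>a = 0\<close> regular.
\<close>

definition cubic_frame :: "(nat \<Rightarrow> complex) \<Rightarrow> complex \<Rightarrow> complex \<Rightarrow> nat \<Rightarrow> complex" where
  "cubic_frame f a p n = (-1) ^ n * p ^ (n * (n + 1) div 2) * qpoch a p n * (\<Prod>k<n. f k)
     / (qpoch (p ^ 3) (p ^ 3) n * qpoch (a ^ 2 * p) (p ^ 2) n)"

definition cubic_term :: "complex \<Rightarrow> complex \<Rightarrow> nat \<Rightarrow> complex" where
  "cubic_term a p = cubic_frame (\<lambda>k. a - p ^ (2 * Suc k)) a p"

definition cubic_base :: "complex \<Rightarrow> complex \<Rightarrow> nat \<Rightarrow> complex" where
  "cubic_base a p = cubic_frame (\<lambda>k. a - p ^ (2 * k)) a p"

lemma triangular_Suc: "Suc n * (Suc n + 1) div 2 = n * (n + 1) div 2 + Suc n"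
proof -
  have "Suc n * (Suc n + 1) = n * (n + 1) + Suc n * 2"
    by simp
  then show ?thesis
    by (simp only: div_mult_self1)
qed

lemma cubic_frame_Suc:
  "cubic_frame f a p (Suc n) = - cubic_frame f a p n
     * (p ^ Suc n * (1 - a * p ^ n) * f n / ((1 - p ^ (3 * Suc n)) * (1 - a ^ 2 * p * p ^ (2 * n))))"
proof -
  have "p ^ 3 * (p ^ 3) ^ n = p ^ (3 * Suc n)"
    by (simp add: power_mult power_add)
  moreover have "(p ^ 2) ^ n = p ^ (2 * n)"
    by (simp add: power_mult)
  ultimately show ?thesis
    unfolding cubic_frame_def triangular_Suc qpoch_Suc power_add
    by (simp add: mult_ac)
qed

text \<open>
  Multiplying the summand by \<open>a - 1\<close> prepends the missing factor \<open>k = 0\<close> to \<open>\<Prod> (a - p^(2k+2))\<close>,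
  which exhibits it as a multiple of \<open>cubic_base\<close> without a division by \<open>a - p^(2n)\<close>; that
  difference vanishes for some \<open>a\<close>.
\<close>

lemma cubic_term_via_base:
  "(a - 1) * cubic_term a p n = cubic_base a p n * (a - p ^ (2 * n))"
proof -
  let ?w = "(-1) ^ n * p ^ (n * (n + 1) div 2) * qpoch a p n
     / (qpoch (p ^ 3) (p ^ 3) n * qpoch (a ^ 2 * p) (p ^ 2) n)"
  have "(a - 1) * (\<Prod>k<n. a - p ^ (2 * Suc k)) = (\<Prod>k<Suc n. a - p ^ (2 * k))"
    unfolding prod.lessThan_Suc_shift by simp
  also have "\<dots> = (\<Prod>k<n. a - p ^ (2 * k)) * (a - p ^ (2 * n))"
    by simp
  finally have "?w * ((a - 1) * (\<Prod>k<n. a - p ^ (2 * Suc k)))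
      = ?w * ((\<Prod>k<n. a - p ^ (2 * k)) * (a - p ^ (2 * n)))"
    by (simp only:)
  then show ?thesis
    unfolding cubic_term_def cubic_base_def cubic_frame_def
    by (simp only: times_divide_eq_left times_divide_eq_right mult.assoc mult.left_commute)
qed

text \<open>
  Under \<open>a \<mapsto> a p^2\<close> each factor \<open>a - p^(2k+2)\<close> becomes \<open>p^2 (a - p^(2k))\<close>, and each of the
  shifted factorials in \<open>a\<close> and \<open>a^2 p\<close> gains two factors at its end and loses two at its
  beginning.
\<close>

lemma cubic_term_shift_via_base:
  assumes "norm p < 1" "norm a < 1"
  shows "(1 - a) * (1 - a * p) * cubic_term (a * p ^ 2) p n
    = cubic_base a p n * p ^ (2 * n) * (1 - a * p ^ n) * (1 - a * p ^ Suc n)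
      * (1 - a ^ 2 * p) * (1 - a ^ 2 * p ^ 3)
      / ((1 - a ^ 2 * p * p ^ (2 * n)) * (1 - a ^ 2 * p ^ 3 * p ^ (2 * n)))"
proof -
  let ?w = "(-1) ^ n * p ^ (n * (n + 1) div 2) / qpoch (p ^ 3) (p ^ 3) n"
  let ?V = "\<Prod>k<n. a - p ^ (2 * k)"
  let ?D = "qpoch (a ^ 2 * p) (p ^ 2) n" and ?D' = "qpoch ((a * p ^ 2) ^ 2 * p) (p ^ 2) n"
  let ?A = "1 - a ^ 2 * p" and ?B = "1 - a ^ 2 * p ^ 3"
  let ?d = "1 - a ^ 2 * p * p ^ (2 * n)" and ?e = "1 - a ^ 2 * p ^ 3 * p ^ (2 * n)"
  have small: "norm (a ^ 2 * p) < 1" "norm (a ^ 2 * p ^ 3) < 1"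
    using assms norm_mult_power_less_1[of "a ^ 2" p 1] norm_mult_power_less_1[of "a ^ 2" p 3]
    by (simp_all add: norm_power power_less_one_iff abs_square_less_1)
  have p2: "norm (p ^ 2) \<le> 1"
    using assms by (simp add: norm_power power_le_one)
  have AB: "?A \<noteq> 0" "?B \<noteq> 0"
    using small by (simp_all only: one_minus_nonzero not_False_eq_True)
  have de: "?d \<noteq> 0" "?e \<noteq> 0"
    using one_minus_nonzero[OF norm_mult_power_less_1[OF small(1) p2, of n]]
      one_minus_nonzero[OF norm_mult_power_less_1[OF small(2) p2, of n]]
    by (simp_all add: power_mult)
  have D: "?D \<noteq> 0"
    using small p2 by (intro qpoch_nonzero)
  have DD: "?A * ?B * ?D' = ?D * ?d * ?e"
    using qpoch_shift2[of "a ^ 2 * p" "p ^ 2" n]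
    by (simp add: power_mult power_mult_distrib power2_eq_square power3_eq_cube mult_ac)
  have D': "?D' \<noteq> 0"
    using DD D de AB by auto
  have V: "(\<Prod>k<n. a * p ^ 2 - p ^ (2 * Suc k)) = p ^ (2 * n) * ?V"
  proof -
    have "(\<Prod>k<n. a * p ^ 2 - p ^ (2 * Suc k)) = (\<Prod>k<n. p ^ 2 * (a - p ^ (2 * k)))"
      by (intro prod.cong) (simp_all add: algebra_simps power2_eq_square)
    then show ?thesis
      by (simp add: prod.distrib power_mult)
  qed
  have quot: "1 / ?D' = ?A * ?B / (?D * ?d * ?e)"
    using DD D D' de by (simp add: divide_simps)
  have "(1 - a) * (1 - a * p) * cubic_term (a * p ^ 2) p n
      = ?w * ((1 - a) * (1 - a * p) * qpoch (a * p ^ 2) p n) * (p ^ (2 * n) * ?V) * (1 / ?D')"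
    unfolding cubic_term_def cubic_frame_def V by simp
  also have "\<dots> = ?w * (qpoch a p n * (1 - a * p ^ n) * (1 - a * p ^ Suc n)) * (p ^ (2 * n) * ?V)
      * (?A * ?B / (?D * ?d * ?e))"
    unfolding qpoch_shift2 quot ..
  also have "\<dots> = cubic_base a p n * p ^ (2 * n) * (1 - a * p ^ n) * (1 - a * p ^ Suc n)
      * ?A * ?B / (?d * ?e)"
    unfolding cubic_base_def cubic_frame_def by (simp add: mult_ac)
  finally show ?thesis .
qed

text \<open>
  Up to the factor \<open>a - 1\<close> this is the summand times the rational function
  \[ \frac{a (1 - p^{3n}) (1 - a p^{n+1})}{(a - p^{2n}) (1 - a^2 p^{2n+1})}, \]
  the solution of the telescoping equation that the \<open>q\<close>-analogue of Gosper's algorithm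
  produces: \<open>1 - p^(3n)\<close> cancels the last factor of \<open>(p^3;p^3)_n\<close> and makes the value at
  \<open>n = 0\<close> vanish, and \<open>a (1 - a p^(n+1))\<close> is found by comparing coefficients of powers of \<open>p^n\<close>.
\<close>

definition cubic_certificate :: "complex \<Rightarrow> complex \<Rightarrow> nat \<Rightarrow> complex" where
  "cubic_certificate a p n = a * (1 - p ^ (3 * n)) * (1 - a * p ^ Suc n) * cubic_base a p n
     / (1 - a ^ 2 * p * p ^ (2 * n))"

text \<open>The polynomial identity behind the telescoping, with \<open>P\<close> in the role of \<open>p^n\<close>.\<close>

lemma cubic_certificate_polynomial:
  fixes a p P :: complex
  shows "P ^ 2 * (1 - a * P) * (1 - a * p * P) * (1 - a ^ 3 * p ^ 3)
      + (a - P ^ 2) * (1 - a ^ 2 * p * P ^ 2) * (1 - a ^ 2 * p ^ 3 * P ^ 2)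
    = a * (1 - a * p ^ 2 * P) * (p * P) * (1 - a * P) * (a - P ^ 2)
      + a * (1 - P ^ 3) * (1 - a * p * P) * (1 - a ^ 2 * p ^ 3 * P ^ 2)"
  by (simp add: algebra_simps eval_nat_numeral)

text \<open>
  Both summands and both certificates are rational multiples of \<open>cubic_base a p n\<close>; after this
  common factor is removed, the polynomial identity remains.
\<close>

lemma cubic_telescope:
  assumes p: "norm p < 1" and a: "norm a < 1"
  shows "(a - 1) * ((1 - a * p) * (1 - a ^ 3 * p ^ 3) * cubic_term (a * p ^ 2) p n
      - (1 - a ^ 2 * p) * (1 - a ^ 2 * p ^ 3) * cubic_term a p n)
    = (1 - a ^ 2 * p) * (1 - a ^ 2 * p ^ 3)
      * (cubic_certificate a p (Suc n) - cubic_certificate a p n)"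
proof -
  define P where "P = p ^ n"
  define E where "E = cubic_base a p n"
  define A where "A = (1 - a ^ 2 * p) * (1 - a ^ 2 * p ^ 3)"
  define d where "d = 1 - a ^ 2 * p * P ^ 2"
  define e where "e = 1 - a ^ 2 * p ^ 3 * P ^ 2"
  define h where "h = 1 - p ^ 3 * P ^ 3"
  define C where "C = 1 - a ^ 3 * p ^ 3"
  have powers: "p ^ (2 * n) = P ^ 2" "p ^ (3 * n) = P ^ 3" "p ^ Suc n = p * P"
    "p ^ (2 * Suc n) = p ^ 2 * P ^ 2" "p ^ (3 * Suc n) = p ^ 3 * P ^ 3"
    "p ^ Suc (Suc n) = p ^ 2 * P" "p ^ n = P"
    unfolding P_def
    by (simp_all add: power_mult power_add power_mult_distrib power2_eq_square power3_eq_cube mult_ac)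
  have P2: "norm (P ^ 2) \<le> 1"
    using p by (simp add: P_def norm_power power_le_one)
  have small: "norm (a ^ 2) < 1"
    using a by (simp add: norm_power abs_square_less_1)
  have nz: "d \<noteq> 0" "e \<noteq> 0" "h \<noteq> 0"
  proof -
    have "norm (a ^ 2 * p ^ k * P ^ 2) < 1" for k
      using norm_mult_power_less_1[OF norm_mult_power_less_1[OF small], of p "P ^ 2" k 1] p P2 by simp
    from this[of 1] this[of 3] show "d \<noteq> 0" "e \<noteq> 0"
      unfolding d_def e_def by auto
    have "norm (p ^ (3 * Suc n)) < 1"
      unfolding norm_power by (intro power_less_one_iff[THEN iffD2]) (use p in auto)
    then show "h \<noteq> 0"
      unfolding h_def powers by auto
  qed
  \<comment> \<open>\<open>x\<close>, \<open>y\<close>, \<open>z\<close> abbreviate the products in the polynomial identity, so that the remaining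
    manipulations of fractions treat them as atoms.\<close>
  define x where "x = P ^ 2 * (1 - a * P) * (1 - a * p * P)"
  define y where "y = a * (1 - a * p ^ 2 * P) * (p * P) * (1 - a * P) * (a - P ^ 2)"
  define z where "z = a * (1 - P ^ 3) * (1 - a * p * P)"
  have poly: "x * C + (a - P ^ 2) * d * e = y + z * e"
    unfolding x_def y_def z_def C_def d_def e_def by (rule cubic_certificate_polynomial)
  have t1: "(1 - a) * (1 - a * p) * cubic_term (a * p ^ 2) p n = A * E * x / (d * e)"
    using cubic_term_shift_via_base[OF p a, of n]
    unfolding powers E_def A_def d_def e_def x_def by (simp only: mult_ac)
  have t2: "(a - 1) * cubic_term a p n = E * (a - P ^ 2)"
    using cubic_term_via_base[of a p n] unfolding powers E_def .
  have g0: "cubic_certificate a p n = E * z / d"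
    unfolding cubic_certificate_def powers E_def d_def z_def by (simp only: mult_ac)
  have "cubic_base a p (Suc n) = - E * (p * P * (1 - a * P) * (a - P ^ 2) / (h * d))"
    unfolding cubic_base_def cubic_frame_Suc powers E_def h_def d_def ..
  then have "cubic_certificate a p (Suc n)
      = a * h * (1 - a * p ^ 2 * P) * (- E * (p * P * (1 - a * P) * (a - P ^ 2) / (h * d))) / e"
    unfolding cubic_certificate_def powers h_def e_def
    by (simp add: power2_eq_square power3_eq_cube mult_ac)
  also have "\<dots> = - (E * y / (d * e))"
    unfolding y_def using nz by (simp add: divide_simps)
  finally have g1: "cubic_certificate a p (Suc n) = - (E * y / (d * e))" .
  have split: "(a - P ^ 2) = (a - P ^ 2) * d * e / (d * e)" "E * z / d = E * (z * e) / (d * e)"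
    using nz by simp_all
  have "(a - 1) * ((1 - a * p) * C * cubic_term (a * p ^ 2) p n - A * cubic_term a p n)
      = - (C * ((1 - a) * (1 - a * p) * cubic_term (a * p ^ 2) p n)) - A * ((a - 1) * cubic_term a p n)"
    by (simp add: algebra_simps)
  also have "\<dots> = - (A * E * ((x * C + (a - P ^ 2) * d * e) / (d * e)))"
    unfolding t1 t2 add_divide_distrib split(1)[symmetric] by (simp add: distrib_left mult_ac)
  also have "\<dots> = A * (- (E * y / (d * e)) - E * (z * e) / (d * e))"
    unfolding poly add_divide_distrib by (simp add: algebra_simps)
  also have "\<dots> = A * (cubic_certificate a p (Suc n) - cubic_certificate a p n)"
    unfolding g0 g1 split(2) ..
  finally show ?thesis
    unfolding A_def C_def by (simp add: mult.assoc)
qed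

section \<open>Convergence\<close>

lemma summable_triangular_power:
  fixes r c :: real
  assumes "0 \<le> r" "r < 1" "0 \<le> c"
  shows "summable (\<lambda>n. r ^ (n * (n + 1) div 2) * c ^ n)"
proof -
  have "(\<lambda>n. r ^ Suc n * c) \<longlonglongrightarrow> 0 * c"
    using assms by (intro tendsto_intros LIMSEQ_Suc LIMSEQ_realpow_zero)
  then have "eventually (\<lambda>n. r ^ Suc n * c < 1 / 2) sequentially"
    by (rule order_tendstoD(2)) simp
  then obtain N where N: "\<And>n. n \<ge> N \<Longrightarrow> r ^ Suc n * c < 1 / 2"
    unfolding eventually_sequentially by blast
  show ?thesis
  proof (rule summable_ratio_test)
    fix n assume "n \<ge> N"
    have "norm (r ^ (Suc n * (Suc n + 1) div 2) * c ^ Suc n)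
        = (r ^ Suc n * c) * (r ^ (n * (n + 1) div 2) * c ^ n)"
      unfolding triangular_Suc power_add using assms by (simp add: abs_mult mult_ac)
    also have "\<dots> \<le> 1 / 2 * (r ^ (n * (n + 1) div 2) * c ^ n)"
      using N[OF \<open>n \<ge> N\<close>] assms by (intro mult_right_mono) auto
    finally show "norm (r ^ (Suc n * (Suc n + 1) div 2) * c ^ Suc n)
        \<le> 1 / 2 * norm (r ^ (n * (n + 1) div 2) * c ^ n)"
      using assms by simp
  qed simp
qed

text \<open>
  Each of the \<open>2n\<close> numerator factors has modulus at most 2 and each of the \<open>2n\<close> denominator factors
  has modulus at least \<open>1 - |p|\<close>. The resulting bound does not depend on \<open>a\<close>, so it serves both
  for convergence and for the passage to the limit \<open>a \<rightarrow> 0\<close>.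
\<close>

definition cubic_majorant :: "real \<Rightarrow> nat \<Rightarrow> real" where
  "cubic_majorant r n = r ^ (n * (n + 1) div 2) * (4 / (1 - r) ^ 2) ^ n"

lemma summable_cubic_majorant:
  assumes "0 \<le> r" "r < 1"
  shows "summable (cubic_majorant r)"
  unfolding cubic_majorant_def using assms by (intro summable_triangular_power) auto

lemma norm_cubic_frame_le:
  assumes p: "norm p < 1" and a: "norm a \<le> 1" and f: "\<And>k. norm (f k) \<le> 2"
  shows "norm (cubic_frame f a p n) \<le> cubic_majorant (norm p) n"
proof -
  let ?r = "norm p"
  have p23: "norm (p ^ 3) \<le> ?r" "norm (p ^ 3) \<le> 1" "norm (p ^ 2) \<le> 1"
    using p power_decreasing[of 1 3 ?r] by (auto simp: norm_power power_le_one)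
  have ap: "norm (a ^ 2 * p) \<le> ?r"
    using a by (simp add: norm_mult norm_power mult_left_le_one_le power_le_one)
  have lower: "(1 - ?r) ^ n * (1 - ?r) ^ n
      \<le> norm (qpoch (p ^ 3) (p ^ 3) n) * norm (qpoch (a ^ 2 * p) (p ^ 2) n)"
    using p p23 ap by (intro mult_mono norm_qpoch_lower) auto
  have "(\<Prod>k<n. norm (f k)) \<le> (\<Prod>k<n. 2)"
    using f by (intro prod_mono) auto
  then have upper: "norm (qpoch a p n) * norm (\<Prod>k<n. f k) \<le> 2 ^ n * 2 ^ n"
    using p a by (intro mult_mono norm_qpoch_upper) (auto simp: prod_norm)
  have "norm (cubic_frame f a p n) = ?r ^ (n * (n + 1) div 2) * (norm (qpoch a p n) * norm (\<Prod>k<n. f k))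
      / (norm (qpoch (p ^ 3) (p ^ 3) n) * norm (qpoch (a ^ 2 * p) (p ^ 2) n))"
    unfolding cubic_frame_def by (simp add: norm_mult norm_divide norm_power)
  also have "\<dots> \<le> ?r ^ (n * (n + 1) div 2) * (2 ^ n * 2 ^ n) / ((1 - ?r) ^ n * (1 - ?r) ^ n)"
    using p lower upper by (intro frac_le mult_left_mono) auto
  also have "\<dots> = cubic_majorant ?r n"
    unfolding cubic_majorant_def
    by (simp add: power_divide power_mult_distrib[symmetric] power2_eq_square)
  finally show ?thesis .
qed

lemma norm_diff_power_le_2:
  fixes a p :: complex
  assumes "norm a \<le> 1" "norm p \<le> 1"
  shows "norm (a - p ^ k) \<le> 2"
  using norm_triangle_ineq4[of a "p ^ k"] assms power_le_one[of "norm p" k]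
  by (simp add: norm_power)

lemma norm_cubic_term_le:
  assumes "norm p < 1" "norm a \<le> 1"
  shows "norm (cubic_term a p n) \<le> cubic_majorant (norm p) n"
  unfolding cubic_term_def
  using assms by (intro norm_cubic_frame_le norm_diff_power_le_2) auto

lemma summable_cubic_term:
  assumes "norm p < 1" "norm a \<le> 1"
  shows "summable (cubic_term a p)"
  using norm_cubic_term_le[OF assms] summable_cubic_majorant[of "norm p"] assms
  by (intro summable_comparison_test[of "cubic_term a p" "cubic_majorant (norm p)"]) auto

lemma cubic_certificate_tendsto_0:
  assumes p: "norm p < 1" and a: "norm a < 1"
  shows "cubic_certificate a p \<longlonglongrightarrow> 0"
proof -
  have "norm (cubic_base a p n) \<le> cubic_majorant (norm p) n" for n
    unfolding cubic_base_def
    using assms by (intro norm_cubic_frame_le norm_diff_power_le_2) auto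
  moreover have "cubic_majorant (norm p) \<longlonglongrightarrow> 0"
    using p by (intro summable_LIMSEQ_zero summable_cubic_majorant) auto
  ultimately have base: "cubic_base a p \<longlonglongrightarrow> 0"
    by (intro Lim_null_comparison[of "cubic_base a p" "cubic_majorant (norm p)"]) auto
  have "(\<lambda>n. p ^ (k * n)) \<longlonglongrightarrow> 0" if "k > 0" for k
    unfolding power_mult using p that
    by (intro LIMSEQ_power_zero) (simp add: norm_power power_less_one_iff)
  from this[of 2] this[of 3] LIMSEQ_Suc[OF this[of 1]]
  have "(\<lambda>n. a * (1 - p ^ (3 * n)) * (1 - a * p ^ Suc n) * cubic_base a p n
      / (1 - a ^ 2 * p * p ^ (2 * n))) \<longlonglongrightarrow> a * (1 - 0) * (1 - a * 0) * 0 / (1 - a ^ 2 * p * 0)"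
    by (intro tendsto_intros base) auto
  then show ?thesis
    unfolding cubic_certificate_def by simp
qed

section \<open>Summing the series\<close>

definition cubic_sum :: "complex \<Rightarrow> complex \<Rightarrow> complex" where
  "cubic_sum a p = (\<Sum>n. cubic_term a p n)"

text \<open>The telescoping relation summed over all \<open>n\<close>: the certificate contributes nothing at either end.\<close>

lemma cubic_sum_shift:
  assumes p: "norm p < 1" and a: "norm a < 1"
  shows "(1 - a ^ 2 * p) * (1 - a ^ 2 * p ^ 3) * cubic_sum a p
    = (1 - a * p) * (1 - a ^ 3 * p ^ 3) * cubic_sum (a * p ^ 2) p"
proof -
  let ?A = "(1 - a ^ 2 * p) * (1 - a ^ 2 * p ^ 3)" and ?B = "(1 - a * p) * (1 - a ^ 3 * p ^ 3)"
  have ap2: "norm (a * p ^ 2) \<le> 1"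
    using norm_mult_power_less_1[of a p 2] p a by simp
  have "(\<lambda>n. (a - 1) * (?B * cubic_term (a * p ^ 2) p n - ?A * cubic_term a p n))
      sums ((a - 1) * (?B * cubic_sum (a * p ^ 2) p - ?A * cubic_sum a p))"
    unfolding cubic_sum_def using p a ap2
    by (intro sums_mult sums_diff summable_sums summable_cubic_term) auto
  moreover have "(\<lambda>n. ?A * (cubic_certificate a p (Suc n) - cubic_certificate a p n))
      sums (?A * (0 - cubic_certificate a p 0))"
    by (intro sums_mult telescope_sums cubic_certificate_tendsto_0 p a)
  ultimately have "(a - 1) * (?B * cubic_sum (a * p ^ 2) p - ?A * cubic_sum a p)
      = ?A * (0 - cubic_certificate a p 0)"
    unfolding cubic_telescope[OF p a] by (rule sums_unique2)
  then have "(a - 1) * (?B * cubic_sum (a * p ^ 2) p - ?A * cubic_sum a p) = 0"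
    by (simp add: cubic_certificate_def)
  moreover have "a - 1 \<noteq> 0"
    using a by auto
  ultimately show ?thesis
    by simp
qed

text \<open>
  The two factors that one step contributes on the left, \<open>1 - a^2 p\<close> and \<open>1 - a^2 p^3\<close>, are
  consecutive in base \<open>p^2\<close>, while the step multiplies \<open>a^2 p\<close> by \<open>p^4\<close>; hence the length \<open>2m\<close>.
\<close>

lemma cubic_sum_shift_iterated:
  assumes p: "norm p < 1" and a: "norm a < 1"
  shows "qpoch (a ^ 2 * p) (p ^ 2) (2 * m) * cubic_sum a p
    = qpoch (a * p) (p ^ 2) m * qpoch (a ^ 3 * p ^ 3) (p ^ 6) m * cubic_sum (a * p ^ (2 * m)) p"
proof (induction m)
  case 0
  then show ?case by simp
next
  case (Suc m)
  let ?b = "a * p ^ (2 * m)"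
  let ?D = "qpoch (a ^ 2 * p) (p ^ 2) (2 * m)"
    and ?N = "qpoch (a * p) (p ^ 2) m * qpoch (a ^ 3 * p ^ 3) (p ^ 6) m"
  have b: "norm ?b < 1"
    using p a by (intro norm_mult_power_less_1) auto
  have D: "qpoch (a ^ 2 * p) (p ^ 2) (2 * Suc m) = ?D * ((1 - ?b ^ 2 * p) * (1 - ?b ^ 2 * p ^ 3))"
    by (simp add: qpoch_Suc power_mult power_mult_distrib power2_eq_square power3_eq_cube mult_ac)
  have N: "qpoch (a * p) (p ^ 2) (Suc m) * qpoch (a ^ 3 * p ^ 3) (p ^ 6) (Suc m)
      = ?N * ((1 - ?b * p) * (1 - ?b ^ 3 * p ^ 3))"
  proof -
    have "(p ^ 6) ^ m = (p ^ (2 * m)) ^ 3" "(p ^ 2) ^ m = p ^ (2 * m)"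
      by (simp_all flip: power_mult)
    then show ?thesis
      by (simp add: qpoch_Suc power_mult_distrib mult_ac)
  qed
  have b': "?b * p ^ 2 = a * p ^ (2 * Suc m)"
    by (simp add: power_add power2_eq_square mult_ac)
  have "?D * ((1 - ?b ^ 2 * p) * (1 - ?b ^ 2 * p ^ 3)) * cubic_sum a p
      = (1 - ?b ^ 2 * p) * (1 - ?b ^ 2 * p ^ 3) * (?D * cubic_sum a p)"
    by (simp only: mult_ac)
  also have "\<dots> = ?N * ((1 - ?b ^ 2 * p) * (1 - ?b ^ 2 * p ^ 3) * cubic_sum ?b p)"
    unfolding Suc.IH by (simp only: mult_ac)
  also have "\<dots> = ?N * ((1 - ?b * p) * (1 - ?b ^ 3 * p ^ 3)) * cubic_sum (a * p ^ (2 * Suc m)) p"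
    unfolding cubic_sum_shift[OF p b] b' by (simp only: mult_ac)
  finally show ?case
    unfolding D N .
qed

lemma cubic_sum_tendsto_at_0:
  assumes p: "norm p < 1" and b: "b \<longlonglongrightarrow> 0" "\<And>m. norm (b m) \<le> 1"
  shows "(\<lambda>m. cubic_sum (b m) p) \<longlonglongrightarrow> cubic_sum 0 p"
proof -
  have "(\<lambda>m. cubic_term (b m) p n) \<longlonglongrightarrow> cubic_term 0 p n" for n
  proof -
    have "qpoch (p ^ 3) (p ^ 3) n \<noteq> 0"
      using p by (intro qpoch_nonzero) (auto simp: norm_power power_less_one_iff power_le_one)
    \<comment> \<open>The denominator at \<open>a = 0\<close>, in the expanded form in which the limit rules present it.\<close>
    then have "(\<Prod>k<n. 1 - p ^ 3 * (p ^ 3) ^ k) * (\<Prod>k<n. 1 - 0 ^ 2 * p * (p ^ 2) ^ k) \<noteq> 0"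
      by (simp add: qpoch_def)
    then show ?thesis
      unfolding cubic_term_def cubic_frame_def qpoch_def
      by (intro tendsto_intros b(1))
  qed
  moreover have "eventually (\<lambda>(n, m). norm (cubic_term (b m) p n) \<le> cubic_majorant (norm p) n)
      (at_top \<times>\<^sub>F sequentially)"
    using norm_cubic_term_le[OF p b(2)] by (intro always_eventually) auto
  ultimately show ?thesis
    unfolding cubic_sum_def using p
    by (intro tannerys_theorem[where M = "cubic_majorant (norm p)", THEN conjunct2, THEN conjunct2]
        summable_cubic_majorant) auto
qed

lemma cubic_sum_eq_at_0:
  assumes p: "norm p < 1" and a: "norm a < 1"
  shows "qpoch_inf (a ^ 2 * p) (p ^ 2) * cubic_sum a p
    = qpoch_inf (a * p) (p ^ 2) * qpoch_inf (a ^ 3 * p ^ 3) (p ^ 6) * cubic_sum 0 p"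
proof -
  have pk: "norm (p ^ k) < 1" if "k > 0" for k
    using p that by (simp add: norm_power power_less_one_iff)
  have "(\<lambda>m. a * (p ^ 2) ^ m) \<longlonglongrightarrow> a * 0"
    using pk by (intro tendsto_intros LIMSEQ_power_zero) auto
  moreover have "norm (a * p ^ (2 * m)) \<le> 1" for m
    using norm_mult_power_less_1[OF a, of p "2 * m"] p by simp
  ultimately have lim: "(\<lambda>m. cubic_sum (a * p ^ (2 * m)) p) \<longlonglongrightarrow> cubic_sum 0 p"
    using p by (intro cubic_sum_tendsto_at_0) (auto simp: power_mult)
  have "strict_mono (\<lambda>m::nat. 2 * m)"
    by (simp add: strict_mono_def)
  from LIMSEQ_subseq_LIMSEQ[OF qpoch_tendsto_qpoch_inf[OF pk[of 2]] this]
  have "(\<lambda>m. qpoch (a ^ 2 * p) (p ^ 2) (2 * m) * cubic_sum a p)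
      \<longlonglongrightarrow> qpoch_inf (a ^ 2 * p) (p ^ 2) * cubic_sum a p"
    by (intro tendsto_intros) (simp add: o_def)
  moreover have "(\<lambda>m. qpoch (a ^ 2 * p) (p ^ 2) (2 * m) * cubic_sum a p)
      \<longlonglongrightarrow> qpoch_inf (a * p) (p ^ 2) * qpoch_inf (a ^ 3 * p ^ 3) (p ^ 6) * cubic_sum 0 p"
    unfolding cubic_sum_shift_iterated[OF p a]
    using pk by (intro tendsto_intros lim qpoch_tendsto_qpoch_inf) auto
  ultimately show ?thesis
    by (rule LIMSEQ_unique)
qed

text \<open>All terms after the first contain the factor \<open>a - p^2\<close>.\<close>

lemma cubic_sum_p2: "cubic_sum (p ^ 2) p = 1"
proof -
  have "cubic_term (p ^ 2) p n = 0" if "n \<noteq> 0" for n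
  proof -
    have "(\<Prod>k<n. p ^ 2 - p ^ (2 * Suc k)) = 0"
      using that by (intro prod_zero) (auto simp: power2_eq_square intro!: bexI[of _ 0])
    then show ?thesis
      by (simp add: cubic_term_def cubic_frame_def)
  qed
  then have "cubic_sum (p ^ 2) p = (\<Sum>n\<in>{0}. cubic_term (p ^ 2) p n)"
    unfolding cubic_sum_def by (intro suminf_finite) auto
  then show ?thesis
    by (simp add: cubic_term_def cubic_frame_def)
qed

text \<open>
  The special case \<open>a = p^2\<close>, used to determine the constant. Its product side is
  \<open>(p^3;p^2)_\<infinity> (p^9;p^6)_\<infinity> / (p^5;p^2)_\<infinity>\<close>, which collapses to \<open>(1 - p^3) (p^9;p^6)_\<infinity> = (p^3;p^6)_\<infinity>\<close>.
\<close>

lemma cubic_sum_at_0: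
  assumes p: "norm p < 1"
  shows "qpoch_inf (p ^ 3) (p ^ 6) * cubic_sum 0 p = 1"
proof -
  have pk: "norm (p ^ k) < 1" if "k > 0" for k
    using p that by (simp add: norm_power power_less_one_iff)
  have "qpoch_inf (p ^ 5) (p ^ 2)
      = qpoch_inf (p ^ 3) (p ^ 2) * qpoch_inf (p ^ 9) (p ^ 6) * cubic_sum 0 p"
    using cubic_sum_eq_at_0[OF p pk[of 2]]
    by (simp add: cubic_sum_p2 flip: power_mult power_add power_Suc2)
  moreover have "qpoch_inf (p ^ 3) (p ^ 2) = (1 - p ^ 3) * qpoch_inf (p ^ 5) (p ^ 2)"
    using qpoch_inf_shift[OF pk[of 2], of "p ^ 3"] by (simp flip: power_add)
  moreover have "qpoch_inf (p ^ 3) (p ^ 6) = (1 - p ^ 3) * qpoch_inf (p ^ 9) (p ^ 6)"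
    using qpoch_inf_shift[OF pk[of 6], of "p ^ 3"] by (simp flip: power_add)
  moreover have "qpoch_inf (p ^ 5) (p ^ 2) \<noteq> 0"
    using pk by (intro qpoch_inf_nonzero) auto
  ultimately show ?thesis
    by (simp add: mult_ac)
qed

theorem cubic_summation:
  assumes p: "norm p < 1" and a: "norm a < 1"
  shows "cubic_term a p sums (qpoch_inf (a * p) (p ^ 2) * qpoch_inf (a ^ 3 * p ^ 3) (p ^ 6)
    / (qpoch_inf (a ^ 2 * p) (p ^ 2) * qpoch_inf (p ^ 3) (p ^ 6)))"
proof -
  have pk: "norm (p ^ k) < 1" if "k > 0" for k
    using p that by (simp add: norm_power power_less_one_iff)
  have "norm (a ^ 2 * p) < 1"
    using norm_mult_power_less_1[of "a ^ 2" p 1] p a by (simp add: norm_power abs_square_less_1)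
  then have "qpoch_inf (a ^ 2 * p) (p ^ 2) \<noteq> 0"
    by (intro qpoch_inf_nonzero pk) auto
  moreover have "qpoch_inf (p ^ 3) (p ^ 6) \<noteq> 0"
    by (intro qpoch_inf_nonzero pk) auto
  moreover have "cubic_sum a p * (qpoch_inf (a ^ 2 * p) (p ^ 2) * qpoch_inf (p ^ 3) (p ^ 6))
      = qpoch_inf (a * p) (p ^ 2) * qpoch_inf (a ^ 3 * p ^ 3) (p ^ 6)"
  proof -
    have "cubic_sum a p * (qpoch_inf (a ^ 2 * p) (p ^ 2) * qpoch_inf (p ^ 3) (p ^ 6))
        = qpoch_inf (a ^ 2 * p) (p ^ 2) * cubic_sum a p * qpoch_inf (p ^ 3) (p ^ 6)"
      by (simp only: mult_ac)
    also have "\<dots> = qpoch_inf (a * p) (p ^ 2) * qpoch_inf (a ^ 3 * p ^ 3) (p ^ 6)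
        * (qpoch_inf (p ^ 3) (p ^ 6) * cubic_sum 0 p)"
      unfolding cubic_sum_eq_at_0[OF p a] by (simp only: mult_ac)
    finally show ?thesis
      by (simp only: cubic_sum_at_0[OF p] mult_1_right)
  qed
  ultimately have "cubic_sum a p = qpoch_inf (a * p) (p ^ 2) * qpoch_inf (a ^ 3 * p ^ 3) (p ^ 6)
      / (qpoch_inf (a ^ 2 * p) (p ^ 2) * qpoch_inf (p ^ 3) (p ^ 6))"
    by (simp add: eq_divide_eq)
  moreover have "cubic_term a p sums cubic_sum a p"
    unfolding cubic_sum_def using p a by (intro summable_sums summable_cubic_term) auto
  ultimately show ?thesis
    by simp
qed

text \<open>
  Here the relation \<open>a^3 = p\<close> enters: it gives \<open>p^2 / a = a^2 p = q^5\<close>, so that the product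
  \<open>\<Prod> (a - p^(2k+2))\<close> is \<open>a^n (a^2 p;p^2)_n\<close> and cancels against the denominator. The powers of \<open>q\<close> combine to \<open>3 n(n+1)/2 + n = n(3n+5)/2\<close>.
\<close>

lemma cubic_term_cube_base:
  assumes "norm q < 1"
  shows "cubic_term q (q ^ 3) n
    = (-1) ^ n * q ^ (n * (3 * n + 5) div 2) * qpoch q (q ^ 3) n / qpoch (q ^ 9) (q ^ 9) n"
proof -
  have "(\<Prod>k<n. q - (q ^ 3) ^ (2 * Suc k)) = (\<Prod>k<n. q * (1 - q ^ 5 * (q ^ 6) ^ k))"
  proof (intro prod.cong refl)
    fix k
    have "(q ^ 3) ^ (2 * Suc k) = q * (q ^ 5 * (q ^ 6) ^ k)"
      by (simp flip: power_mult power_add power_Suc)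
    then show "q - (q ^ 3) ^ (2 * Suc k) = q * (1 - q ^ 5 * (q ^ 6) ^ k)"
      by (simp only: right_diff_distrib mult_1_right)
  qed
  then have num: "(\<Prod>k<n. q - (q ^ 3) ^ (2 * Suc k)) = q ^ n * qpoch (q ^ 5) (q ^ 6) n"
    by (simp add: prod.distrib qpoch_def)
  have "3 * (n * (n + 1) div 2) + n = n * (3 * n + 5) div 2"
  proof -
    have "even (n * (n + 1))"
      by simp
    then obtain t where t: "n * (n + 1) = 2 * t"
      by (elim evenE)
    have "n * (3 * n + 5) = 3 * (n * (n + 1)) + 2 * n"
      by (simp add: algebra_simps)
    with t show ?thesis
      by simp
  qed
  then have expo: "(q ^ 3) ^ (n * (n + 1) div 2) * q ^ n = q ^ (n * (3 * n + 5) div 2)"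
    by (simp flip: power_mult power_add)
  have "qpoch (q ^ 5) (q ^ 6) n \<noteq> 0"
    using assms by (intro qpoch_nonzero) (auto simp: norm_power power_less_one_iff power_le_one)
  moreover have "q ^ 2 * q ^ 3 = q ^ 5" "(q ^ 3) ^ 2 = q ^ 6" "(q ^ 3) ^ 3 = q ^ 9"
    by (simp_all flip: power_mult power_add)
  ultimately show ?thesis
    unfolding cubic_term_def cubic_frame_def num expo[symmetric] by (simp add: mult_ac)
qed

theorem theorem1p3:
  fixes q :: complex
  assumes "norm q < 1"
  shows "(\<lambda>n. (-1) ^ n * q ^ (n * (3 * n + 5) div 2) * qpoch q (q ^ 3) n / qpoch (q ^ 9) (q ^ 9) n)
    sums (qpoch_inf (q ^ 4) (q ^ 6) * qpoch_inf (q ^ 12) (q ^ 18)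
          / (qpoch_inf (q ^ 5) (q ^ 6) * qpoch_inf (q ^ 9) (q ^ 18)))"
proof -
  have "norm (q ^ 3) < 1"
    using assms by (simp add: norm_power power_less_one_iff)
  from cubic_summation[OF this assms] show ?thesis
    unfolding cubic_term_cube_base[OF assms, symmetric]
    by (simp flip: power_mult power_add power_Suc)
qed

end
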